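(* Let $(x,y)\in\mathbb R^2$ satisfy $|y|>\sqrt2$. Then all the functions below are defined at the indicated points and $$\left(\cosh^2\!\big(f^0_{\mathrm{Dil.Cat}}\big)\prod_{k\neq 0}\frac{\cosh^2\!\big(f^k_{\mathrm{Dil.Cat}}\big)}{\pi^2k^2}\right)\Bigg|_{(x,y)}=\frac12\left[\cosh^2\!\left(\frac{f_{\mathrm{ScherkTower}}(x,y)}{\sqrt2}\right)+\cosh^2\!\left(\frac{f_{\mathrm{ScherkTower}}(0,y)}{\sqrt2}\right)\right].$$
   Context: The dilated catenoids are the graphs of $$f^k_{\mathrm{Dil.Cat}}(x,y)=\cosh^{-1}\Big[\sqrt{\left(\tfrac x2+k\pi\right)^2+\left(\tfrac y{\sqrt2}\right)^2}\Big]\quad(k\in\mathbb Z),$$ and Scherk's tower is the graph of $$f_{\mathrm{ScherkTower}}(x,y)=\sqrt2\,\cosh^{-1}\Big[\sqrt{\sinh^2\!\left(\tfrac y{\sqrt2}\right)+2\sin^2\!\left(\tfrac x2\right)}\Big].$$ Here $\cosh^{-1}:[1,\infty)\to[0,\infty)$, and each function is defined where the argument of $\cosh^{-1}$ is at least $1$. The product over $k\neq0$ runs over all nonzero integers and is understood as the limit of the symmetric partial products $\prod_{0<|k|\le N}$ as $N\to\infty$. *)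

theory Defs
  imports Complex_Main
begin

text \<open>
  The library function \<open>arcosh :: real \<Rightarrow> real\<close> is total, and agrees with the inverse hyperbolic
  cosine \<open>[1,\<infinity>) \<rightarrow> [0,\<infinity>)\<close> only on \<open>[1,\<infinity>)\<close>.  The arguments of \<open>arcosh\<close> are therefore named
  separately, and the domains of the height functions are the sets on which they are at least 1.
\<close>

definition dil_cat_arg :: "int \<Rightarrow> real \<Rightarrow> real \<Rightarrow> real" where
  "dil_cat_arg k x y = sqrt ((x / 2 + of_int k * pi)\<^sup>2 + (y / sqrt 2)\<^sup>2)"

definition dil_cat_dom :: "int \<Rightarrow> (real \<times> real) set" where
  "dil_cat_dom k = {(x, y). dil_cat_arg k x y \<ge> 1}"

definition dil_cat :: "int \<Rightarrow> real \<Rightarrow> real \<Rightarrow> real" where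
  "dil_cat k x y = arcosh (dil_cat_arg k x y)"

definition scherk_tower_arg :: "real \<Rightarrow> real \<Rightarrow> real" where
  "scherk_tower_arg x y = sqrt ((sinh (y / sqrt 2))\<^sup>2 + 2 * (sin (x / 2))\<^sup>2)"

definition scherk_tower_dom :: "(real \<times> real) set" where
  "scherk_tower_dom = {(x, y). scherk_tower_arg x y \<ge> 1}"

definition scherk_tower :: "real \<Rightarrow> real \<Rightarrow> real" where
  "scherk_tower x y = sqrt 2 * arcosh (scherk_tower_arg x y)"

definition sym_partial_prod :: "(int \<Rightarrow> real) \<Rightarrow> nat \<Rightarrow> real" where
  "sym_partial_prod a N = (\<Prod>k\<in>{k. 0 < \<bar>k\<bar> \<and> \<bar>k\<bar> \<le> int N}. a k)"

text \<open>
  Only meaningful if the symmetric partial products converge, since \<open>lim\<close> is unspecified otherwise.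
\<close>

definition sym_prod :: "(int \<Rightarrow> real) \<Rightarrow> real" where
  "sym_prod a = lim (sym_partial_prod a)"

end

theory Submission
  imports Defs "HOL-Analysis.Gamma_Function"
begin

text \<open>
  With \<open>w = x/2 + \<i> y/\<surd>2\<close>, the hyperbolic cosine of the \<open>k\<close>-th dilated catenoid is \<open>\<bar>w + k\<pi>\<bar>\<close>, so
  that the left-hand side is the squared modulus of Euler's product
  \<open>sin w = w \<Prod>\<^sub>k\<^sub>\<ge>\<^sub>1 (1 - w\<^sup>2 / (k\<pi>)\<^sup>2)\<close>, in which the factors for \<open>k\<close> and \<open>-k\<close> are paired.
  The right-hand side is \<open>sin\<^sup>2 (x/2) + sinh\<^sup>2 (y/\<surd>2) = \<bar>sin w\<bar>\<^sup>2\<close>.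
\<close>

text \<open>The derivative \<open>cosh s - 1\<close> of \<open>sinh s - s\<close> is nonnegative,
  and oddness covers negative arguments. This carries the bound on \<open>y\<close> over to the
  domain of Scherk's tower.\<close>

lemma abs_le_abs_sinh: "\<bar>x\<bar> \<le> \<bar>sinh x\<bar>" for x :: real
proof -
  have nonneg: "t \<le> sinh t" if "t \<ge> 0" for t :: real
  proof -
    have "sinh 0 - 0 \<le> sinh t - t"
    proof (rule DERIV_nonneg_imp_nondecreasing[OF that])
      fix s :: real
      have "((\<lambda>u. sinh u - u) has_real_derivative cosh s - 1) (at s)"
        by (auto intro!: derivative_eq_intros)
      then show "\<exists>d. ((\<lambda>u. sinh u - u) has_real_derivative d) (at s) \<and> 0 \<le> d"
        using cosh_real_ge_1[of s] by force
    qed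
    then show ?thesis by simp
  qed
  then show ?thesis
    using nonneg[of x] nonneg[of "-x"] by (cases "x \<ge> 0") auto
qed

text \<open>After eliminating \<open>cosh\<close> and \<open>cos\<close> by the Pythagorean
  identities, the mixed terms in \<open>sin a\<close> and \<open>sinh b\<close> cancel.\<close>

lemma norm_sin_Complex_squared: "(cmod (sin (Complex a b)))\<^sup>2 = (sin a)\<^sup>2 + (sinh b)\<^sup>2"
proof -
  have "(cmod (sin (Complex a b)))\<^sup>2 = (sin a * cosh b)\<^sup>2 + (cos a * sinh b)\<^sup>2"
    by (simp add: cmod_power2 Re_sin Im_sin cosh_def sinh_def exp_minus)
  also have "\<dots> = (sin a)\<^sup>2 + (sinh b)\<^sup>2"
    by (simp add: power_mult_distrib cosh_square_eq cos_squared_eq algebra_simps)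
  finally show ?thesis .
qed

lemma sym_partial_prod_eq: "sym_partial_prod a N = (\<Prod>n=1..N. a (int n) * a (- int n))"
proof (induction N)
  case 0
  have "{k::int. 0 < \<bar>k\<bar> \<and> \<bar>k\<bar> \<le> int 0} = {}" by auto
  then show ?case unfolding sym_partial_prod_def by simp
next
  case (Suc N)
  let ?A = "\<lambda>N. {k::int. 0 < \<bar>k\<bar> \<and> \<bar>k\<bar> \<le> int N}"
  have "?A (Suc N) = insert (int (Suc N)) (insert (- int (Suc N)) (?A N))" by auto
  moreover have "finite (?A N)" by (rule finite_subset[of _ "{-int N..int N}"]) auto
  ultimately have "prod a (?A (Suc N)) = a (int (Suc N)) * (a (- int (Suc N)) * prod a (?A N))"
    by simp
  with Suc show ?case by (simp add: sym_partial_prod_def mult_ac)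
qed

text \<open>The product omits \<open>k = 0\<close>, whose factor would be the squared modulus of
  \<open>w\<close>; hence the denominator of the limit.\<close>

lemma norm_sin_product:
  fixes w :: complex
  assumes "w \<noteq> 0"
  shows "sym_partial_prod (\<lambda>k. (cmod (w + of_int k * of_real pi))\<^sup>2 / (pi\<^sup>2 * (of_int k)\<^sup>2))
           \<longlonglongrightarrow> (cmod (sin w))\<^sup>2 / (cmod w)\<^sup>2"
proof -
  \<comment> \<open>Rescaling to match the library form of Euler's product, which expands
    \<open>sin (of_real pi * z)\<close>.\<close>
  define z where "z = w / of_real pi"
  have w: "w = of_real pi * z" by (simp add: z_def)
  have pair: "(cmod (w + of_int (int n) * of_real pi))\<^sup>2 / (pi\<^sup>2 * (of_int (int n))\<^sup>2) *
        ((cmod (w + of_int (- int n) * of_real pi))\<^sup>2 / (pi\<^sup>2 * (of_int (- int n))\<^sup>2))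
      = (cmod (1 - z\<^sup>2 / (of_nat n)\<^sup>2))\<^sup>2" if "n \<ge> 1" for n
  proof -
    \<comment> \<open>A difference of two squares; its sign disappears on taking norms.\<close>
    have eq: "(w + of_int (int n) * of_real pi) * (w + of_int (- int n) * of_real pi)
        = - (of_real pi * of_nat n)\<^sup>2 * (1 - z\<^sup>2 / (of_nat n)\<^sup>2)"
      using that by (simp add: w field_simps power2_eq_square)
    have "cmod (w + of_int (int n) * of_real pi) * cmod (w + of_int (- int n) * of_real pi)
        = cmod (- (of_real pi * of_nat n)\<^sup>2 * (1 - z\<^sup>2 / (of_nat n)\<^sup>2))"
      by (simp only: eq flip: norm_mult)
    also have "\<dots> = (pi * n)\<^sup>2 * cmod (1 - z\<^sup>2 / (of_nat n)\<^sup>2)"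
      by (simp add: norm_mult norm_power)
    finally have "(cmod (w + of_int (int n) * of_real pi))\<^sup>2 * (cmod (w + of_int (- int n) * of_real pi))\<^sup>2
        = ((pi * n)\<^sup>2)\<^sup>2 * (cmod (1 - z\<^sup>2 / (of_nat n)\<^sup>2))\<^sup>2"
      by (metis power_mult_distrib)
    then show ?thesis
      using that by (simp add: field_simps power2_eq_square)
  qed
  have "sym_partial_prod (\<lambda>k. (cmod (w + of_int k * of_real pi))\<^sup>2 / (pi\<^sup>2 * (of_int k)\<^sup>2))
      = (\<lambda>N. (cmod (of_real pi * z * (\<Prod>n=1..N. 1 - z\<^sup>2 / (of_nat n)\<^sup>2)))\<^sup>2 / (cmod w)\<^sup>2)"
  proof
    fix N
    have "sym_partial_prod (\<lambda>k. (cmod (w + of_int k * of_real pi))\<^sup>2 / (pi\<^sup>2 * (of_int k)\<^sup>2)) N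
        = (\<Prod>n=1..N. (cmod (1 - z\<^sup>2 / (of_nat n)\<^sup>2))\<^sup>2)"
      unfolding sym_partial_prod_eq by (intro prod.cong refl pair) auto
    also have "\<dots> = (cmod (\<Prod>n=1..N. 1 - z\<^sup>2 / (of_nat n)\<^sup>2))\<^sup>2"
      by (simp add: prod_power_distrib flip: prod_norm)
    \<comment> \<open>Supplies the leading factor \<open>w\<close> of Euler's product, compensated
      by the division.\<close>
    also have "\<dots> = (cmod (w * (\<Prod>n=1..N. 1 - z\<^sup>2 / (of_nat n)\<^sup>2)))\<^sup>2 / (cmod w)\<^sup>2"
      using assms by (simp add: norm_mult power_mult_distrib)
    finally show "sym_partial_prod (\<lambda>k. (cmod (w + of_int k * of_real pi))\<^sup>2 / (pi\<^sup>2 * (of_int k)\<^sup>2)) N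
        = (cmod (of_real pi * z * (\<Prod>n=1..N. 1 - z\<^sup>2 / (of_nat n)\<^sup>2)))\<^sup>2 / (cmod w)\<^sup>2"
      by (simp only: w)
  qed
  moreover have "(\<lambda>N. (cmod (of_real pi * z * (\<Prod>n=1..N. 1 - z\<^sup>2 / (of_nat n)\<^sup>2)))\<^sup>2 / (cmod w)\<^sup>2)
      \<longlonglongrightarrow> (cmod (sin (of_real pi * z)))\<^sup>2 / (cmod w)\<^sup>2"
    using assms by (intro tendsto_intros sin_product_formula_complex) auto
  ultimately show ?thesis by (simp only: w)
qed

theorem proposition2p2:
  fixes x y :: real
  assumes "\<bar>y\<bar> > sqrt 2"
  shows "(\<forall>k. (x, y) \<in> dil_cat_dom k) \<and>
         (x, y) \<in> scherk_tower_dom \<and> (0, y) \<in> scherk_tower_dom \<and>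
         convergent (sym_partial_prod (\<lambda>k. (cosh (dil_cat k x y))\<^sup>2 / (pi\<^sup>2 * (of_int k)\<^sup>2))) \<and>
         (cosh (dil_cat 0 x y))\<^sup>2 *
           sym_prod (\<lambda>k. (cosh (dil_cat k x y))\<^sup>2 / (pi\<^sup>2 * (of_int k)\<^sup>2)) =
         1 / 2 * ((cosh (scherk_tower x y / sqrt 2))\<^sup>2 + (cosh (scherk_tower 0 y / sqrt 2))\<^sup>2)"
proof -
  define b where "b = y / sqrt 2"
  define w where "w = Complex (x / 2) b"
  have b: "\<bar>b\<bar> > 1"
    using assms by (simp add: b_def)
  then have w: "w \<noteq> 0"
    by (auto simp: w_def complex_eq_iff)
  have "\<bar>sinh b\<bar> \<ge> 1"
    using b abs_le_abs_sinh[of b] by linarith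
  then have sinh: "(sinh b)\<^sup>2 \<ge> 1"
    using one_le_power[of "\<bar>sinh b\<bar>" 2] by simp
  have arg_eq: "dil_cat_arg k x y = cmod (w + of_int k * of_real pi)" for k
    by (simp add: dil_cat_arg_def w_def b_def cmod_def)
  \<comment> \<open>A shift by the real number \<open>k * pi\<close> leaves the imaginary part
    \<open>b\<close> unchanged, so one bound serves all \<open>k\<close>.\<close>
  have dom: "dil_cat_arg k x y \<ge> 1" for k
    using b abs_Im_le_cmod[of "w + of_int k * of_real pi"] by (simp add: arg_eq w_def)
  have cosh_cat: "cosh (dil_cat k x y) = cmod (w + of_int k * of_real pi)" for k
    using dom[of k] by (simp add: dil_cat_def cosh_arcosh_real arg_eq)
  have scherk_dom: "scherk_tower_arg t y \<ge> 1" for t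
    using sinh by (simp add: scherk_tower_arg_def b_def add_increasing2)
  have cosh_scherk: "(cosh (scherk_tower t y / sqrt 2))\<^sup>2 = (sinh b)\<^sup>2 + 2 * (sin (t / 2))\<^sup>2" for t
    using scherk_dom[of t] by (simp add: scherk_tower_def cosh_arcosh_real scherk_tower_arg_def b_def)
  have lim: "sym_partial_prod (\<lambda>k. (cosh (dil_cat k x y))\<^sup>2 / (pi\<^sup>2 * (of_int k)\<^sup>2))
      \<longlonglongrightarrow> (cmod (sin w))\<^sup>2 / (cmod w)\<^sup>2"
    unfolding cosh_cat by (rule norm_sin_product[OF w])
  have "(cosh (dil_cat 0 x y))\<^sup>2 * sym_prod (\<lambda>k. (cosh (dil_cat k x y))\<^sup>2 / (pi\<^sup>2 * (of_int k)\<^sup>2))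
      = (cmod (sin w))\<^sup>2"
    \<comment> \<open>The catenoid with \<open>k = 0\<close> contributes exactly the denominator of
      the limit.\<close>
    unfolding sym_prod_def limI[OF lim] using w by (simp add: cosh_cat)
  \<comment> \<open>The sine term vanishes at \<open>(0, y)\<close>, so averaging the two values
    halves the coefficient 2 of the squared sine and keeps the \<open>sinh\<close> term.\<close>
  also have "\<dots> = 1 / 2 * ((cosh (scherk_tower x y / sqrt 2))\<^sup>2 + (cosh (scherk_tower 0 y / sqrt 2))\<^sup>2)"
    by (simp add: cosh_scherk w_def norm_sin_Complex_squared)
  finally show ?thesis
    using dom scherk_dom lim by (auto simp: dil_cat_dom_def scherk_tower_dom_def convergent_def)
qed

end
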